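(* Let $T>0$, $I=[-T,T]$, $m\in\mathbb{R}$ with $m\neq k\pi/T$ for every $k\in\mathbb{Z}$, $h\in L^1(I)$, $c\in\mathbb{R}$, and let $F\in W^{1,1}(I)'$ be such that $F(\cos mt)\neq F(\sin mt)$ (that is, $F$ takes different values on the functions $t\mapsto\cos mt$ and $t\mapsto\sin mt$). Then the problem $$x'(t)+m\,x(-t)=h(t)\ \text{ for a.e. } t\in I,\qquad F(x)=c,$$ has a unique solution $u\in W^{1,1}(I)$, and it is given by $$u(t)=\int_{-T}^{T}\overline{G}(t,s)h(s)\,ds+\frac{c-F\left(\int_{-T}^{T}\overline{G}(\cdot,s)h(s)\,ds\right)}{F(\overline{G}(\cdot,-T))}\,\overline{G}(t,-T),\qquad t\in I.$$
   Context: $W^{1,1}(I)$ is the Sobolev space of (absolutely continuous) functions $f:I\to\mathbb{R}$ with $f'\in L^1(I)$, and $W^{1,1}(I)'$ is its dual (continuous linear functionals). $\overline{G}$ is the Green's function of the periodic problem $x'(t)+m\,x(-t)=h(t)$, $t\in I$, $x(-T)=x(T)$. Explicitly, with $\alpha=mT$, $t=zT$, $s=yT$, $z,y\in[-1,1]$: $$\sin(\alpha)\,\overline{G}(t,s)=\begin{cases}\cos[\alpha(1-z)-\frac{\pi}{4}]\cos(\alpha y-\frac{\pi}{4}) & \text{if } z>|y|,\\ \cos(\alpha z+\frac{\pi}{4})\cos[\alpha(y-1)-\frac{\pi}{4}] & \text{if } |z|<y,\\ \cos(\alpha z+\frac{\pi}{4})\cos[\alpha(1+y)-\frac{\pi}{4}]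 & \text{if } -|z|>y,\\ \cos[\alpha(z+1)+\frac{\pi}{4}]\cos(\alpha y-\frac{\pi}{4}) & \text{if } z<-|y|.\end{cases}$$ It extends continuously across the points with $z=-y\ne 0$ and has a jump across the diagonal $z=y$; values on the diagonal do not affect the integrals. The function $t\mapsto\overline{G}(t,-T)$ is understood on all of $I$ as $\overline{G}(t,-T)=\dfrac{\cos mt-\sin mt}{2\sin mT}$, which is the unique solution of $x'(t)+m\,x(-t)=0$, $x(-T)-x(T)=1$. *)

theory Defs
  imports "HOL-Analysis.Analysis"
begin

text \<open>
  Functions on a compact interval \<open>I\<close> are represented by total functions \<open>real \<Rightarrow> real\<close>, and only
  their values on \<open>I\<close> are relevant: \<open>deriv f\<close> enters solely through statements and integrals over
  \<open>I\<close> up to null sets, so its values at the end points of \<open>I\<close> play no role.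

  In the definition of absolute continuity a finite family of non-overlapping compact subintervals
  of \<open>I\<close> is encoded as a division \<open>\<D>\<close> of its own union; \<open>Inf K\<close> and \<open>Sup K\<close> are the end points of
  \<open>K \<in> \<D>\<close>.
\<close>

definition abs_continuous_on :: "real set \<Rightarrow> (real \<Rightarrow> real) \<Rightarrow> bool" where
  "abs_continuous_on I f \<longleftrightarrow>
    (\<forall>\<epsilon>>0. \<exists>\<delta>>0. \<forall>\<D>. \<D> division_of \<Union>\<D> \<and> \<Union>\<D> \<subseteq> I \<and> (\<Sum>K\<in>\<D>. Sup K - Inf K) < \<delta> \<longrightarrow>
       (\<Sum>K\<in>\<D>. \<bar>f (Sup K) - f (Inf K)\<bar>) < \<epsilon>)"

definition sobolev_W11 :: "real set \<Rightarrow> (real \<Rightarrow> real) set" where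
  "sobolev_W11 I = {f. abs_continuous_on I f \<and>
     (AE t in lebesgue. t \<in> I \<longrightarrow> f differentiable (at t)) \<and>
     set_integrable lebesgue I (deriv f)}"

definition norm_W11 :: "real set \<Rightarrow> (real \<Rightarrow> real) \<Rightarrow> real" where
  "norm_W11 I f = (LINT t:I|lebesgue. \<bar>f t\<bar>) + (LINT t:I|lebesgue. \<bar>deriv f t\<bar>)"

text \<open>
  Since \<open>norm_W11 I (\<lambda>t. f t - g t) = 0\<close> whenever \<open>f\<close> and \<open>g\<close> agree on \<open>I\<close>, continuity and
  linearity force the members of the dual to depend only on the values of their argument on \<open>I\<close>.
\<close>

definition dual_W11 :: "real set \<Rightarrow> ((real \<Rightarrow> real) \<Rightarrow> real) set" where
  "dual_W11 I = {F.
     (\<forall>f\<in>sobolev_W11 I. \<forall>g\<in>sobolev_W11 I. F (\<lambda>t. f t + g t) = F f + F g) \<and>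
     (\<forall>f\<in>sobolev_W11 I. \<forall>r. F (\<lambda>t. r * f t) = r * F f) \<and>
     (\<forall>f\<in>sobolev_W11 I. \<forall>\<epsilon>>0. \<exists>\<delta>>0. \<forall>g\<in>sobolev_W11 I.
        norm_W11 I (\<lambda>t. g t - f t) < \<delta> \<longrightarrow> \<bar>F g - F f\<bar> < \<epsilon>)}"

text \<open>
  The Green's function of the periodic problem \<open>x'(t) + m x(-t) = h(t)\<close>, \<open>x(-T) = x(T)\<close>. The
  order of the tests fixes the values on the lines \<open>\<bar>z\<bar> = \<bar>y\<bar>\<close>. On the antidiagonal \<open>z = -y \<noteq> 0\<close>
  they are those of the continuous extension. On the diagonal \<open>z = y\<close>, where the function jumps,
  they are a mere convention, chosen so that \<open>green_per T m t (-T)\<close> is given by one formula for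
  all \<open>t \<in> {-T..T}\<close>, including \<open>t = -T\<close>.
\<close>

definition green_per :: "real \<Rightarrow> real \<Rightarrow> real \<Rightarrow> real \<Rightarrow> real" where
  "green_per T m t s = (let \<alpha> = m * T; z = t / T; y = s / T in
     (if z > \<bar>y\<bar> then cos (\<alpha> * (1 - z) - pi / 4) * cos (\<alpha> * y - pi / 4)
      else if z < - \<bar>y\<bar> then cos (\<alpha> * (z + 1) + pi / 4) * cos (\<alpha> * y - pi / 4)
      else if \<bar>z\<bar> \<le> y then cos (\<alpha> * z + pi / 4) * cos (\<alpha> * (y - 1) - pi / 4)
      else cos (\<alpha> * z + pi / 4) * cos (\<alpha> * (1 + y) - pi / 4)) / sin \<alpha>)"

lemma green_per_left_endpoint:
  assumes "T > 0" "t \<in> {-T..T}"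
  shows "green_per T m t (-T) = (cos (m * t) - sin (m * t)) / (2 * sin (m * T))"
proof -
  have z: "\<not> t / T > \<bar>- T / T\<bar>" "\<not> t / T < - \<bar>- T / T\<bar>" "\<not> \<bar>t / T\<bar> \<le> - T / T"
    using assms by (auto simp: field_simps)
  have "cos (m * t + pi / 4) * cos (pi / 4) = (cos (m * t) - sin (m * t)) * (sqrt 2 / 2 * (sqrt 2 / 2))"
    unfolding cos_add cos_45 sin_45 by (simp only: left_diff_distrib mult.assoc)
  then have c: "cos (m * T * (t / T) + pi / 4) * cos (m * T * (1 + - T / T) - pi / 4) = (cos (m * t) - sin (m * t)) / 2"
    using assms by simp
  show ?thesis
    unfolding green_per_def Let_def if_not_P[OF z(1)] if_not_P[OF z(2)] if_not_P[OF z(3)] c by simp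
qed

definition is_solution ::
  "real \<Rightarrow> real \<Rightarrow> (real \<Rightarrow> real) \<Rightarrow> ((real \<Rightarrow> real) \<Rightarrow> real) \<Rightarrow> real \<Rightarrow> (real \<Rightarrow> real) \<Rightarrow> bool" where
  "is_solution T m h F c x \<longleftrightarrow>
     x \<in> sobolev_W11 {-T..T} \<and>
     (AE t in lebesgue. t \<in> {-T..T} \<longrightarrow> deriv x t + m * x (- t) = h t) \<and>
     F x = c"

end

theory Submission
  imports Defs
begin

text \<open>
  Write $C$ and $S$ for the primitives of $\cos(ms)h(s)$ and $\sin(ms)h(s)$ vanishing at $-T$. By
  variation of constants, for every $r$ the function
  \[\cos(mt)\,(C(t)-S(-t))+\sin(mt)\,(S(t)-C(-t))+r\,(\cos mt-\sin mt)\]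
  lies in $W^{1,1}$ and solves the equation almost everywhere; this uses that $C$ and $S$ are
  absolutely continuous with the expected derivatives almost everywhere. Expanding the Green's
  function shows that $w$ has this form for one particular $r$, and adding a multiple of
  $\overline{G}(\cdot,-T)$ only changes $r$.

  For uniqueness, let $d$ solve the homogeneous equation. Then $d(t)\cos mt+d(-t)\sin mt$ and
  $d(-t)\cos mt-d(t)\sin mt$ are absolutely continuous with derivative $0$ almost everywhere, hence
  constant, so $d(t)=d(0)(\cos mt-\sin mt)$. As $F(d)=0$ and $F(\cos mt)\neq F(\sin mt)$, this forces
  $d(0)=0$.
\<close>

section \<open>Intervals of a division, and null sets under reflection\<close>

lemma division_member_Icc:
  fixes I :: "real set"
  assumes "\<D> division_of S" "S \<subseteq> I" "K \<in> \<D>"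
  obtains u v where "K = {u..v}" "u \<le> v" "{u..v} \<subseteq> I" "Inf K = u" "Sup K = v"
proof -
  obtain u v where K: "K = {u..v}"
    using division_ofD(4)[OF assms(1,3)] by auto
  moreover have "K \<noteq> {}" "K \<subseteq> I"
    using division_ofD(2,3)[OF assms(1,3)] assms(2) by auto
  ultimately show thesis
    using that[of u v] by auto
qed

lemma AE_lebesgue_negligible:
  "(AE x in lebesgue. P x) \<longleftrightarrow> negligible {x. \<not> P x}" for P :: "'a::euclidean_space \<Rightarrow> bool"
  by (simp add: completion.AE_iff_null_sets negligible_iff_null_sets)

text \<open>The equation couples \<open>t\<close> with \<open>- t\<close>, so exceptional null sets
  have to be reflected as well. The reflected set is null as the image of a null set under a
  differentiable map.\<close>

lemma AE_lebesgue_reflect: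
  assumes "AE x::real in lebesgue. P x"
  shows "AE x in lebesgue. P (- x)"
proof -
  have "negligible (uminus ` {x. \<not> P x})"
    using assms by (intro negligible_differentiable_image_negligible)
      (auto simp: AE_lebesgue_negligible intro!: derivative_intros)
  moreover have "uminus ` {x. \<not> P x} = {x. \<not> P (- x)}"
    by (auto simp: image_iff) (metis minus_minus)
  ultimately show ?thesis
    by (simp add: AE_lebesgue_negligible)
qed

lemma AE_lebesgue_neq: "AE x::real in lebesgue. x \<noteq> a"
  by (simp add: AE_lebesgue_negligible)

subsection \<open>Absolutely continuous functions\<close>

text \<open>A common comparison principle: an estimate of the increments on each interval sums to an
  estimate over every division, so the bounds of \<open>f\<close> and \<open>g\<close> for
  \<open>\<epsilon> / (2 * A)\<close> serve for \<open>k\<close>. Sums, products and continuously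
  differentiable functions are reduced to it.\<close>

lemma abs_continuous_on_dominated:
  assumes "abs_continuous_on I f" "abs_continuous_on I g"
    and "A > 0"
    and le: "\<And>u v. u \<le> v \<Longrightarrow> {u..v} \<subseteq> I \<Longrightarrow>
      \<bar>k v - k u\<bar> \<le> A * (\<bar>f v - f u\<bar> + \<bar>g v - g u\<bar>)"
  shows "abs_continuous_on I k"
  unfolding abs_continuous_on_def
proof (intro allI impI)
  fix \<epsilon> :: real assume "\<epsilon> > 0"
  then have e: "\<epsilon> / (2 * A) > 0"
    using \<open>A > 0\<close> by simp
  obtain d1 where d1: "d1 > 0" "\<And>\<D>. \<D> division_of \<Union>\<D> \<Longrightarrow> \<Union>\<D> \<subseteq> I \<Longrightarrow>
      (\<Sum>K\<in>\<D>. Sup K - Inf K) < d1 \<Longrightarrow> (\<Sum>K\<in>\<D>. \<bar>f (Sup K) - f (Inf K)\<bar>) < \<epsilon> / (2 * A)"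
    using assms(1) e unfolding abs_continuous_on_def by meson
  obtain d2 where d2: "d2 > 0" "\<And>\<D>. \<D> division_of \<Union>\<D> \<Longrightarrow> \<Union>\<D> \<subseteq> I \<Longrightarrow>
      (\<Sum>K\<in>\<D>. Sup K - Inf K) < d2 \<Longrightarrow> (\<Sum>K\<in>\<D>. \<bar>g (Sup K) - g (Inf K)\<bar>) < \<epsilon> / (2 * A)"
    using assms(2) e unfolding abs_continuous_on_def by meson
  show "\<exists>\<delta>>0. \<forall>\<D>. \<D> division_of \<Union>\<D> \<and> \<Union>\<D> \<subseteq> I \<and> (\<Sum>K\<in>\<D>. Sup K - Inf K) < \<delta> \<longrightarrow>
       (\<Sum>K\<in>\<D>. \<bar>k (Sup K) - k (Inf K)\<bar>) < \<epsilon>"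
  proof (intro exI[of _ "min d1 d2"] conjI allI impI; (elim conjE)?)
    fix \<D> assume D: "\<D> division_of \<Union>\<D>" "\<Union>\<D> \<subseteq> I" "(\<Sum>K\<in>\<D>. Sup K - Inf K) < min d1 d2"
    have "(\<Sum>K\<in>\<D>. \<bar>k (Sup K) - k (Inf K)\<bar>) \<le>
        (\<Sum>K\<in>\<D>. A * (\<bar>f (Sup K) - f (Inf K)\<bar> + \<bar>g (Sup K) - g (Inf K)\<bar>))"
    proof (rule sum_mono)
      fix K assume "K \<in> \<D>"
      then obtain u v where "u \<le> v" "{u..v} \<subseteq> I" "Inf K = u" "Sup K = v"
        using division_member_Icc D by metis
      then show "\<bar>k (Sup K) - k (Inf K)\<bar> \<le> A * (\<bar>f (Sup K) - f (Inf K)\<bar> + \<bar>g (Sup K) - g (Inf K)\<bar>)"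
        using le by simp
    qed
    also have "\<dots> = A * ((\<Sum>K\<in>\<D>. \<bar>f (Sup K) - f (Inf K)\<bar>) + (\<Sum>K\<in>\<D>. \<bar>g (Sup K) - g (Inf K)\<bar>))"
      by (simp flip: sum_distrib_left sum.distrib)
    also have "\<dots> < A * (\<epsilon> / (2 * A) + \<epsilon> / (2 * A))"
      using d1(2)[OF D(1,2)] d2(2)[OF D(1,2)] D(3) \<open>A > 0\<close>
      by (intro mult_strict_left_mono add_strict_mono) auto
    also have "\<dots> = \<epsilon>"
      using \<open>A > 0\<close> by (simp add: field_simps)
    finally show "(\<Sum>K\<in>\<D>. \<bar>k (Sup K) - k (Inf K)\<bar>) < \<epsilon>" .
  qed (use d1 d2 in auto)
qed

lemma abs_continuous_on_cong:
  assumes "abs_continuous_on I f" "\<And>t. t \<in> I \<Longrightarrow> f t = g t"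
  shows "abs_continuous_on I g"
  proof (rule abs_continuous_on_dominated[OF assms(1,1), of 1])
  fix u v assume "u \<le> v" "{u..v} \<subseteq> I"
  then have "f u = g u" "f v = g v"
    using assms(2) by (simp_all add: subset_iff)
  then show "\<bar>g v - g u\<bar> \<le> 1 * (\<bar>f v - f u\<bar> + \<bar>f v - f u\<bar>)"
    by simp
qed simp

lemma abs_continuous_on_add:
  assumes "abs_continuous_on I f" "abs_continuous_on I g"
  shows "abs_continuous_on I (\<lambda>t. f t + g t)"
  by (rule abs_continuous_on_dominated[OF assms, of 1]) auto

text \<open>Continuity is the case of a division consisting of one interval.\<close>

lemma abs_continuous_on_imp_continuous_on:
  assumes "abs_continuous_on {a..b} f"
  shows "continuous_on {a..b} f"
  unfolding continuous_on_iff
proof (intro ballI allI impI)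
  fix x \<epsilon> :: real assume x: "x \<in> {a..b}" and "\<epsilon> > 0"
  then obtain d where d: "d > 0" "\<And>\<D>. \<D> division_of \<Union>\<D> \<Longrightarrow> \<Union>\<D> \<subseteq> {a..b} \<Longrightarrow>
      (\<Sum>K\<in>\<D>. Sup K - Inf K) < d \<Longrightarrow> (\<Sum>K\<in>\<D>. \<bar>f (Sup K) - f (Inf K)\<bar>) < \<epsilon>"
    using assms unfolding abs_continuous_on_def by meson
  have *: "\<bar>f v - f u\<bar> < \<epsilon>" if "u \<in> {a..b}" "v \<in> {a..b}" "u \<le> v" "v - u < d" for u v
  proof -
    have "{{u..v}} division_of \<Union>{{u..v}}"
      using division_of_self[of u v] that by (simp add: box_real)
    then show ?thesis
      using d(2)[of "{{u..v}}"] that by auto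
  qed
  show "\<exists>d>0. \<forall>y\<in>{a..b}. dist y x < d \<longrightarrow> dist (f y) (f x) < \<epsilon>"
  proof (intro exI[of _ d] conjI ballI impI)
    fix y assume "y \<in> {a..b}" "dist y x < d"
    then show "dist (f y) (f x) < \<epsilon>"
      using *[of x y] *[of y x] x by (cases x y rule: linorder_cases) (auto simp: dist_real_def \<open>\<epsilon> > 0\<close>)
  qed (rule d(1))
qed

text \<open>Both factors are continuous, hence bounded by some \<open>M\<close> on the compact
  interval, and changing one factor at a time dominates the increments of the product.\<close>

lemma abs_continuous_on_mult:
  assumes f: "abs_continuous_on {a..b} f" and g: "abs_continuous_on {a..b} g"
  shows "abs_continuous_on {a..b} (\<lambda>t. f t * g t)"
proof -
  have "bounded (f ` {a..b} \<union> g ` {a..b})"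
    using f g by (simp add: compact_imp_bounded compact_continuous_image abs_continuous_on_imp_continuous_on)
  then obtain M where M: "M > 0" "\<And>t. t \<in> {a..b} \<Longrightarrow> \<bar>f t\<bar> \<le> M \<and> \<bar>g t\<bar> \<le> M"
    unfolding bounded_pos by auto
  show ?thesis
  proof (rule abs_continuous_on_dominated[OF f g M(1)])
    fix u v assume "u \<le> v" "{u..v} \<subseteq> {a..b}"
    then have uv: "u \<in> {a..b}" "v \<in> {a..b}"
      by auto
    have "\<bar>f v * g v - f u * g u\<bar> = \<bar>(f v - f u) * g v + f u * (g v - g u)\<bar>"
      by (simp add: algebra_simps)
    also have "\<dots> \<le> \<bar>f v - f u\<bar> * \<bar>g v\<bar> + \<bar>f u\<bar> * \<bar>g v - g u\<bar>"
      by (metis abs_mult abs_triangle_ineq)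
    also have "\<dots> \<le> \<bar>f v - f u\<bar> * M + M * \<bar>g v - g u\<bar>"
      using M(2) uv less_imp_le[OF M(1)] by (intro add_mono mult_mono) auto
    finally show "\<bar>f v * g v - f u * g u\<bar> \<le> M * (\<bar>f v - f u\<bar> + \<bar>g v - g u\<bar>)"
      by (simp add: algebra_simps)
  qed
qed

text \<open>The mirror image of a division is a division of the same total length. The end points of
  each interval exchange roles, which the absolute value absorbs.\<close>

lemma abs_continuous_on_reflect:
  assumes "abs_continuous_on {-T..T} f"
  shows "abs_continuous_on {-T..T} (\<lambda>t. f (- t))"
  unfolding abs_continuous_on_def
proof (intro allI impI)
  fix \<epsilon> :: real assume "\<epsilon> > 0"
  then obtain d where d: "d > 0" "\<And>\<D>. \<D> division_of \<Union>\<D> \<Longrightarrow> \<Union>\<D> \<subseteq> {-T..T} \<Longrightarrow>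
      (\<Sum>K\<in>\<D>. Sup K - Inf K) < d \<Longrightarrow> (\<Sum>K\<in>\<D>. \<bar>f (Sup K) - f (Inf K)\<bar>) < \<epsilon>"
    using assms unfolding abs_continuous_on_def by meson
  show "\<exists>\<delta>>0. \<forall>\<D>. \<D> division_of \<Union>\<D> \<and> \<Union>\<D> \<subseteq> {-T..T} \<and> (\<Sum>K\<in>\<D>. Sup K - Inf K) < \<delta> \<longrightarrow>
       (\<Sum>K\<in>\<D>. \<bar>f (- Sup K) - f (- Inf K)\<bar>) < \<epsilon>"
  proof (intro exI[of _ d] conjI allI impI; (elim conjE)?)
    fix \<D> assume D: "\<D> division_of \<Union>\<D>" "\<Union>\<D> \<subseteq> {-T..T}" "(\<Sum>K\<in>\<D>. Sup K - Inf K) < d"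
    let ?m = "(`) (uminus :: real \<Rightarrow> real)"
    have inj: "inj_on ?m \<D>"
      by (auto simp: inj_on_def inj_image_eq_iff)
    have div: "?m ` \<D> division_of \<Union>(?m ` \<D>)"
      unfolding division_of_def
    proof (intro conjI ballI impI)
      show "finite (?m ` \<D>)"
        using D(1) by auto
      fix K1 assume "K1 \<in> ?m ` \<D>"
      then obtain K where K: "K \<in> \<D>" "K1 = ?m K"
        by auto
      then obtain u v where uv: "K = {u..v}" "u \<le> v"
        using division_member_Icc[OF D(1,2)] by metis
      show "K1 \<subseteq> \<Union>(?m ` \<D>)" "K1 \<noteq> {}" "\<exists>a b. K1 = cbox a b"
        using K uv by auto
      fix K2 assume "K2 \<in> ?m ` \<D>" "K1 \<noteq> K2"
      then obtain L where L: "L \<in> \<D>" "K2 = ?m L" "K \<noteq> L"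
        using K by auto
      then have "interior K \<inter> interior L = {}"
        using division_ofD(5)[OF D(1)] K(1) by blast
      then show "interior K1 \<inter> interior K2 = {}"
        using K(2) L(2) by (auto simp: interior_negations)
    qed auto
    have ends: "Inf (?m K) = - Sup K \<and> Sup (?m K) = - Inf K" if "K \<in> \<D>" for K
    proof -
      obtain u v where "K = {u..v}" "u \<le> v"
        using division_member_Icc[OF D(1,2) \<open>K \<in> \<D>\<close>] by metis
      then show ?thesis
        by simp
    qed
    have "\<Union>(?m ` \<D>) \<subseteq> {-T..T}"
      using D(2) by force
    moreover have "(\<Sum>K\<in>?m ` \<D>. Sup K - Inf K) < d"
      using D(3) ends by (simp add: sum.reindex[OF inj] algebra_simps)
    ultimately have "(\<Sum>K\<in>?m ` \<D>. \<bar>f (Sup K) - f (Inf K)\<bar>) < \<epsilon>"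
      using d(2)[OF div] by blast
    then show "(\<Sum>K\<in>\<D>. \<bar>f (- Sup K) - f (- Inf K)\<bar>) < \<epsilon>"
      using ends by (simp add: sum.reindex[OF inj] abs_minus_commute)
  qed (rule d(1))
qed

section \<open>Constancy from a derivative vanishing almost everywhere\<close>

lemma abs_continuous_on_subset:
  assumes "abs_continuous_on I f" "J \<subseteq> I"
  shows "abs_continuous_on J f"
  using assms unfolding abs_continuous_on_def by (meson order_trans)

text \<open>
  The gauge at a point with derivative \<open>0\<close> is a ball on which the increments of \<open>f\<close> are at most
  \<open>\<epsilon>\<close> times the length; at the remaining points it is an open neighbourhood of the null set of
  measure so small that absolute continuity bounds the sum of those increments by \<open>\<epsilon>\<close>.
\<close>

lemma abs_continuous_on_zero_deriv_endpoints:
  assumes f: "abs_continuous_on {a..b} f" and "a \<le> b"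
    and ae: "AE t in lebesgue. t \<in> {a..b} \<longrightarrow> (f has_real_derivative 0) (at t)"
  shows "f a = f b"
proof -
  define N where "N = {t. \<not> (t \<in> {a..b} \<longrightarrow> (f has_real_derivative 0) (at t))}"
  have "negligible N"
    using ae by (simp add: N_def AE_lebesgue_negligible)
  \<comment> \<open>The length \<open>b - a\<close> accounts for the tags outside \<open>N\<close>,
    the additional \<open>1\<close> for the tags in \<open>N\<close>.\<close>
  have "\<bar>f b - f a\<bar> \<le> \<epsilon> * (b - a + 1)" if "\<epsilon> > 0" for \<epsilon>
  proof -
    obtain d where d: "d > 0" "\<And>\<D>. \<D> division_of \<Union>\<D> \<Longrightarrow> \<Union>\<D> \<subseteq> {a..b} \<Longrightarrow>
        (\<Sum>K\<in>\<D>. Sup K - Inf K) < d \<Longrightarrow> (\<Sum>K\<in>\<D>. \<bar>f (Sup K) - f (Inf K)\<bar>) < \<epsilon>"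
      using f \<open>\<epsilon> > 0\<close> unfolding abs_continuous_on_def by meson
    obtain U where U: "open U" "N \<subseteq> U" "U \<in> lmeasurable" "measure lebesgue U < d"
    proof -
      have "N \<in> sets lebesgue"
        using \<open>negligible N\<close> negligible_iff_null_sets by auto
      moreover obtain U where "open U" "N \<subseteq> U" "U - N \<in> lmeasurable" "emeasure lebesgue (U - N) < ennreal d"
        using sets_lebesgue_outer_open[OF \<open>N \<in> sets lebesgue\<close> d(1)] by metis
      moreover have "U - N \<union> N = U"
        using \<open>N \<subseteq> U\<close> by auto
      moreover have "N \<in> lmeasurable"
        using \<open>negligible N\<close> by (simp add: negligible_imp_measurable)
      ultimately have "U \<in> lmeasurable" "measure lebesgue U \<le> measure lebesgue (U - N) + measure lebesgue N"
        by (metis fmeasurable.Un, metis measure_Un_le fmeasurableD)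
      moreover have "measure lebesgue (U - N) < d"
        using \<open>emeasure lebesgue (U - N) < ennreal d\<close> \<open>U - N \<in> lmeasurable\<close> \<open>d > 0\<close>
        by (simp add: emeasure_eq_measure2 ennreal_less_iff)
      moreover have "measure lebesgue N = 0"
        using \<open>negligible N\<close> by (simp add: negligible_imp_measure0)
      ultimately have "U \<in> lmeasurable" "measure lebesgue U < d"
        by auto
      then show thesis
        using that \<open>open U\<close> \<open>N \<subseteq> U\<close> by blast
    qed
    have "\<exists>r>0. t \<in> {a..b} \<longrightarrow> (\<forall>y. \<bar>y - t\<bar> < r \<longrightarrow> \<bar>f y - f t\<bar> \<le> \<epsilon> * \<bar>y - t\<bar>)" if "t \<notin> N" for t
    proof (cases "t \<in> {a..b}")
      case True
      then have "(f has_derivative (\<lambda>h. 0)) (at t)"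
        using that by (auto simp: N_def has_field_derivative_def lambda_zero)
      then obtain r where "r > 0" "\<forall>y. norm (y - t) < r \<longrightarrow> norm (f y - f t - 0) \<le> \<epsilon> * norm (y - t)"
        using \<open>\<epsilon> > 0\<close> by (auto simp: has_derivative_at_alt)
      then show ?thesis
        by auto
    qed (auto intro: exI[of _ 1])
    then obtain r where r: "\<And>t. t \<notin> N \<Longrightarrow> r t > 0"
      "\<And>t y. t \<notin> N \<Longrightarrow> t \<in> {a..b} \<Longrightarrow> \<bar>y - t\<bar> < r t \<Longrightarrow> \<bar>f y - f t\<bar> \<le> \<epsilon> * \<bar>y - t\<bar>"
      by metis
    define \<gamma> where "\<gamma> t = (if t \<in> N then U else ball t (r t))" for t
    have "gauge \<gamma>"
      using U(1,2) r(1) by (auto simp: gauge_def \<gamma>_def)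
    then obtain p where p: "p tagged_division_of {a..b}" "\<gamma> fine p"
      using fine_division_exists_real by blast
    have "finite p"
      using p(1) by blast
    define p1 where "p1 = {(x, K) \<in> p. x \<in> N}"
    have p1: "p1 tagged_partial_division_of {a..b}"
      using p(1) by (auto simp: p1_def tagged_division_of_def intro: tagged_partial_division_subset)
    let ?D = "snd ` p1"
    have D: "?D division_of \<Union>?D" "\<Union>?D \<subseteq> {a..b}"
      using partial_division_of_tagged_division[OF p1] tagged_partial_division_ofD(3)[OF p1] by force+
    have t1: "p1 tagged_division_of \<Union>?D"
      using tagged_partial_division_of_Union_self[OF p1] .
    \<comment> \<open>The passage from tagged pairs to intervals asks for a summand vanishing on
      every box with empty interior. This includes the empty box, whose \<open>Inf\<close> and
      \<open>Sup\<close> carry no information, hence the explicit value 0.\<close>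
    define e where "e K = (if K = {} then 0 else \<bar>f (Sup K) - f (Inf K)\<bar>)" for K
    have box: "e (cbox u v) = 0" if "box u v = {}" for u v
      using that by (cases "u = v") (auto simp: e_def)
    have "(\<Sum>K\<in>?D. Sup K - Inf K) = (\<Sum>K\<in>?D. measure lebesgue K)"
    proof (rule sum.cong)
      fix K assume "K \<in> ?D"
      then obtain u v where "K = {u..v}" "u \<le> v"
        using division_member_Icc[OF D(1,2)] by metis
      then show "Sup K - Inf K = measure lebesgue K"
        by simp
    qed auto
    also have "\<dots> = measure lebesgue (\<Union>?D)"
      by (rule content_division[OF D(1)])
    also have "\<dots> \<le> measure lebesgue U"
    proof (rule measure_mono_fmeasurable)
      show "\<Union>?D \<subseteq> U"
        using p(2) by (fastforce simp: p1_def fine_def \<gamma>_def)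
      show "\<Union>?D \<in> sets lebesgue"
        using lmeasurable_division[OF D(1)] by blast
    qed (rule U(3))
    finally have "(\<Sum>K\<in>?D. \<bar>f (Sup K) - f (Inf K)\<bar>) < \<epsilon>"
      using d(2)[OF D] U(4) by linarith
    moreover have "(\<Sum>K\<in>?D. \<bar>f (Sup K) - f (Inf K)\<bar>) = (\<Sum>K\<in>?D. e K)"
      using division_ofD(3)[OF D(1)] by (intro sum.cong) (auto simp: e_def)
    moreover have "(\<Sum>(x,K)\<in>p1. \<bar>f (Sup K) - f (Inf K)\<bar>) = (\<Sum>(x,K)\<in>p1. e K)"
      using tagged_partial_division_ofD(2)[OF p1]
      by (intro sum.cong refl) (clarsimp simp: e_def, blast)
    ultimately have s1: "(\<Sum>(x,K)\<in>p1. \<bar>f (Sup K) - f (Inf K)\<bar>) < \<epsilon>"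
      using sum.over_tagged_division_lemma[OF t1, of e] box by simp
    have len: "0 \<le> Sup K - Inf K" if "(x, K) \<in> p" for x K
      using tagged_division_ofD(2,4)[OF p(1) that] by auto
    have "(\<Sum>(x,K)\<in>p - p1. \<bar>f (Sup K) - f (Inf K)\<bar>) \<le> (\<Sum>(x,K)\<in>p - p1. \<epsilon> * (Sup K - Inf K))"
    proof (rule sum_mono, clarify)
      fix x K assume "(x, K) \<in> p" "(x, K) \<notin> p1"
      then have "x \<notin> N" "x \<in> K" "K \<subseteq> {a..b}" "K \<subseteq> \<gamma> x"
        using tagged_division_ofD(2,3)[OF p(1)] fineD[OF p(2)] unfolding p1_def by blast+
      then have "x \<notin> N" "x \<in> K" "K \<subseteq> {a..b}" "K \<subseteq> ball x (r x)"
        by (simp_all add: \<gamma>_def)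
      moreover obtain u v where "K = {u..v}"
        using tagged_division_ofD(4)[OF p(1) \<open>(x, K) \<in> p\<close>] by auto
      ultimately have K: "K = {u..v}" "u \<le> x" "x \<le> v" "x \<in> {a..b}" and "K \<subseteq> ball x (r x)"
        by auto
      \<comment> \<open>The gauge controls increments from the tag \<open>x\<close> only, so the
        increment over \<open>K\<close> is split at \<open>x\<close>.\<close>
      then have "u \<in> ball x (r x)" "v \<in> ball x (r x)"
        by (simp_all add: subset_iff)
      with K have "\<bar>f u - f x\<bar> \<le> \<epsilon> * (x - u)" "\<bar>f v - f x\<bar> \<le> \<epsilon> * (v - x)"
        using r(2)[OF \<open>x \<notin> N\<close>, of u] r(2)[OF \<open>x \<notin> N\<close>, of v] by (auto simp: dist_real_def)
      then show "\<bar>f (Sup K) - f (Inf K)\<bar> \<le> \<epsilon> * (Sup K - Inf K)"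
        using K(1-3) by (simp add: algebra_simps)
    qed
    also have "\<dots> \<le> (\<Sum>(x,K)\<in>p. \<epsilon> * (Sup K - Inf K))"
      using len \<open>\<epsilon> > 0\<close> by (intro sum_mono2 \<open>finite p\<close>) auto
    also have "\<dots> = \<epsilon> * (b - a)"
      using additive_tagged_division_1[OF \<open>a \<le> b\<close> p(1), of "\<lambda>t. t"]
      by (simp add: case_prod_unfold flip: sum_distrib_left)
    finally have s2: "(\<Sum>(x,K)\<in>p - p1. \<bar>f (Sup K) - f (Inf K)\<bar>) \<le> \<epsilon> * (b - a)" .
    have "\<bar>f b - f a\<bar> = \<bar>\<Sum>(x,K)\<in>p. f (Sup K) - f (Inf K)\<bar>"
      using additive_tagged_division_1[OF \<open>a \<le> b\<close> p(1), of f] by simp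
    also have "\<dots> \<le> (\<Sum>(x,K)\<in>p. \<bar>f (Sup K) - f (Inf K)\<bar>)"
      unfolding case_prod_unfold by (rule sum_abs)
    also have "\<dots> = (\<Sum>(x,K)\<in>p - p1. \<bar>f (Sup K) - f (Inf K)\<bar>) + (\<Sum>(x,K)\<in>p1. \<bar>f (Sup K) - f (Inf K)\<bar>)"
      using \<open>finite p\<close> by (intro sum.subset_diff) (auto simp: p1_def)
    finally show ?thesis
      using s1 s2 by (simp add: algebra_simps)
  qed
  then have *: "\<bar>f b - f a\<bar> / (b - a + 1) \<le> \<epsilon>" if "\<epsilon> > 0" for \<epsilon>
    using that \<open>a \<le> b\<close> by (simp add: divide_le_eq)
  have "\<bar>f b - f a\<bar> / (b - a + 1) \<le> 0"
    by (rule field_le_epsilon) (use * in simp)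
  then show ?thesis
    using \<open>a \<le> b\<close> by (simp add: divide_le_0_iff)
qed

lemma abs_continuous_on_zero_deriv:
  assumes f: "abs_continuous_on {a..b} f"
    and ae: "AE t in lebesgue. t \<in> {a..b} \<longrightarrow> (f has_real_derivative 0) (at t)"
    and "u \<in> {a..b}" "v \<in> {a..b}"
  shows "f u = f v"
proof -
  have *: "f u = f v" if "u \<in> {a..b}" "v \<in> {a..b}" "u \<le> v" for u v
  proof (rule abs_continuous_on_zero_deriv_endpoints[OF _ that(3)])
    show "abs_continuous_on {u..v} f"
      using f that by (auto intro: abs_continuous_on_subset)
    show "AE t in lebesgue. t \<in> {u..v} \<longrightarrow> (f has_real_derivative 0) (at t)"
      using ae that by (auto elim!: eventually_mono)
  qed
  show ?thesis
    using * assms(3,4) by (metis linear)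
qed

section \<open>Primitives of integrable functions\<close>

text \<open>Truncating the absolute value of \<open>\<phi>\<close> at a high level \<open>n\<close>
  leaves a remainder \<open>g\<close> with integral below \<open>\<epsilon> / 2\<close>. The
  truncated part is at most \<open>n\<close> and contributes at most \<open>n\<close> times the
  total length of the intervals.\<close>

lemma abs_continuous_on_integral:
  fixes \<phi> :: "real \<Rightarrow> real"
  assumes \<phi>: "\<phi> absolutely_integrable_on {a..b}"
  shows "abs_continuous_on {a..b} (\<lambda>t. integral {a..t} \<phi>)"
  unfolding abs_continuous_on_def
proof (intro allI impI)
  fix \<epsilon> :: real assume "\<epsilon> > 0"
  define f where "f n x = min \<bar>\<phi> x\<bar> (real n)" for n x
  have f_int: "f n integrable_on {a..b}" for n
  proof -
    have "(\<lambda>x. real n) absolutely_integrable_on {a..b}"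
      by (simp add: absolutely_integrable_continuous_real)
    from absolutely_integrable_min[OF set_integrable_abs[OF \<phi>] this]
    have "f n absolutely_integrable_on {a..b}"
      by (simp add: f_def[abs_def])
    then show ?thesis
      by (rule set_lebesgue_integral_eq_integral(1))
  qed
  have abs_int: "(\<lambda>x. \<bar>\<phi> x\<bar>) integrable_on {a..b}" and int: "\<phi> integrable_on {a..b}"
    using set_lebesgue_integral_eq_integral(1) set_integrable_abs[OF \<phi>] \<phi> by blast+
  have "(\<lambda>n. integral {a..b} (f n)) \<longlonglongrightarrow> integral {a..b} (\<lambda>x. \<bar>\<phi> x\<bar>)"
  proof (rule dominated_convergence(2)[OF f_int abs_int])
    fix x
    obtain k where "\<bar>\<phi> x\<bar> \<le> real k"
      using real_arch_simple by blast
    then have "f n x = \<bar>\<phi> x\<bar>" if "n \<ge> k" for n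
      using that by (simp add: f_def)
    then show "(\<lambda>n. f n x) \<longlonglongrightarrow> \<bar>\<phi> x\<bar>"
      by (intro tendsto_eventually) (auto simp: eventually_sequentially)
  qed (auto simp: f_def)
  then obtain n where n: "\<bar>integral {a..b} (f n) - integral {a..b} (\<lambda>x. \<bar>\<phi> x\<bar>)\<bar> < \<epsilon> / 2"
    using \<open>\<epsilon> > 0\<close> by (metis LIMSEQ_iff half_gt_zero le_refl real_norm_def)
  define g where "g x = \<bar>\<phi> x\<bar> - f n x" for x
  have g_int: "g integrable_on {a..b}" and g0: "\<And>x. g x \<ge> 0"
    using integrable_diff[OF abs_int f_int] by (simp_all add: g_def[abs_def] f_def)
  have g_le: "integral {a..b} g < \<epsilon> / 2"
    using n integral_diff[OF abs_int f_int[of n]] unfolding g_def[abs_def] by linarith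
  show "\<exists>\<delta>>0. \<forall>\<D>. \<D> division_of \<Union>\<D> \<and> \<Union>\<D> \<subseteq> {a..b} \<and> (\<Sum>K\<in>\<D>. Sup K - Inf K) < \<delta> \<longrightarrow>
       (\<Sum>K\<in>\<D>. \<bar>integral {a..Sup K} \<phi> - integral {a..Inf K} \<phi>\<bar>) < \<epsilon>"
  \<comment> \<open>With this bound on the total length the truncated part contributes at most
    \<open>\<epsilon> / 2\<close>; the summand 1 keeps the denominator positive for
    \<open>n = 0\<close>.\<close>
  proof (intro exI[of _ "\<epsilon> / (2 * (real n + 1))"] conjI allI impI; (elim conjE)?)
    fix \<D> assume D: "\<D> division_of \<Union>\<D>" "\<Union>\<D> \<subseteq> {a..b}" "(\<Sum>K\<in>\<D>. Sup K - Inf K) < \<epsilon> / (2 * (real n + 1))"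
    have gD: "g integrable_on K" if "K \<in> \<D>" for K
      using division_member_Icc[OF D(1,2) that] integrable_subinterval_real[OF g_int] by metis
    have "(\<Sum>K\<in>\<D>. \<bar>integral {a..Sup K} \<phi> - integral {a..Inf K} \<phi>\<bar>) \<le> (\<Sum>K\<in>\<D>. integral K g + n * (Sup K - Inf K))"
    proof (rule sum_mono)
      fix K assume "K \<in> \<D>"
      then obtain u v where K: "K = {u..v}" "u \<le> v" "{u..v} \<subseteq> {a..b}" "Inf K = u" "Sup K = v"
        using division_member_Icc[OF D(1,2)] by metis
      then have av: "a \<le> u" "{a..v} \<subseteq> {a..b}"
        by auto
      have uv: "\<phi> integrable_on {u..v}" "g integrable_on {u..v}"
        using K(3) int g_int integrable_subinterval_real by blast+
      have gn_int: "(\<lambda>x. g x + n) integrable_on {u..v}"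
        by (intro integrable_add uv(2)) auto
      have "integral {a..u} \<phi> + integral {u..v} \<phi> = integral {a..v} \<phi>"
        using av K(2) int by (intro Henstock_Kurzweil_Integration.integral_combine) (auto intro: integrable_subinterval_real)
      then have "\<bar>integral {a..Sup K} \<phi> - integral {a..Inf K} \<phi>\<bar> = norm (integral {u..v} \<phi>)"
        using K by simp
      also have "\<dots> \<le> integral {u..v} (\<lambda>x. g x + n)"
        using integral_norm_bound_integral[OF uv(1) gn_int] by (simp add: g_def f_def)
      also have "\<dots> = integral K g + n * (Sup K - Inf K)"
        using K uv by (subst integral_add) auto
      finally show "\<bar>integral {a..Sup K} \<phi> - integral {a..Inf K} \<phi>\<bar> \<le> integral K g + n * (Sup K - Inf K)" .
    qed
    also have "\<dots> = integral (\<Union>\<D>) g + n * (\<Sum>K\<in>\<D>. Sup K - Inf K)"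
      using integral_combine_division_bottomup[OF D(1) gD] by (simp add: sum.distrib sum_distrib_left)
    also have "\<dots> \<le> integral {a..b} g + n * (\<epsilon> / (2 * (real n + 1)))"
    proof (intro add_mono mult_left_mono)
      show "integral (\<Union>\<D>) g \<le> integral {a..b} g"
        using D gD g0 by (intro integral_subset_le g_int) (auto intro: integrable_combine_division)
    qed (use D(3) in auto)
    also have "\<dots> < \<epsilon> / 2 + \<epsilon> / 2"
      using g_le \<open>\<epsilon> > 0\<close> by (intro add_less_le_mono) (auto simp: field_simps)
    finally show "(\<Sum>K\<in>\<D>. \<bar>integral {a..Sup K} \<phi> - integral {a..Inf K} \<phi>\<bar>) < \<epsilon>"
      by simp
  qed (use \<open>\<epsilon> > 0\<close> in auto)
qed

text \<open>The one-dimensional case of Lebesgue differentiation over cubes with \<open>x\<close> as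
  lower corner, which is why only averages to the right of \<open>x\<close> are controlled.\<close>

lemma right_lebesgue_point_AE:
  fixes f :: "real \<Rightarrow> real"
  assumes "\<And>u v. f integrable_on {u..v}"
  shows "AE x in lebesgue. \<forall>e>0. \<exists>d>0. \<forall>h. 0 < h \<and> h < d \<longrightarrow> \<bar>integral {x..x + h} f / h - f x\<bar> < e"
proof -
  obtain N where "negligible N"
    and N: "\<And>x e. x \<notin> N \<Longrightarrow> 0 < e \<Longrightarrow> \<exists>d>0. \<forall>h. 0 < h \<and> h < d \<longrightarrow>
      norm (integral (cbox x (x + h *\<^sub>R One)) f /\<^sub>R h ^ DIM(real) - f x) < e"
    using integrable_ccontinuous_explicit[of f] assms by (metis box_real(2))
  then have *: "\<exists>d>0. \<forall>h. 0 < h \<and> h < d \<longrightarrow> \<bar>integral {x..x + h} f / h - f x\<bar> < e" if "x \<notin> N" "e > 0" for x e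
    using N[OF that] by (simp add: divide_inverse mult.commute)
  show ?thesis
    unfolding AE_lebesgue_negligible
    by (rule negligible_subset[OF \<open>negligible N\<close>]) (use * in blast)
qed

text \<open>Difference quotients from the right are right averages at \<open>t\<close>; those from
  the left are right averages of the reflected function at \<open>- t\<close>. Almost everywhere
  both converge to the same value.\<close>

lemma integral_has_real_derivative_AE:
  fixes \<phi> :: "real \<Rightarrow> real"
  assumes \<phi>: "\<phi> integrable_on {a..b}"
  shows "AE t in lebesgue. t \<in> {a..b} \<longrightarrow> ((\<lambda>t. integral {a..t} \<phi>) has_real_derivative \<phi> t) (at t)"
proof -
  \<comment> \<open>Extension by zero gives a function integrable on every interval, as the
    statement on Lebesgue points requires.\<close>
  define f where "f x = (if x \<in> {a..b} then \<phi> x else 0)" for x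
  have f_int: "f integrable_on {u..v}" for u v
  proof -
    have "f integrable_on UNIV"
      using \<phi> integrable_restrict_UNIV[of "{a..b}" \<phi>] unfolding f_def[abs_def] by blast
    then show ?thesis
      using integrable_on_subcbox[of f UNIV u v] by simp
  qed
  have "(\<lambda>x. f (- x)) integrable_on {u..v}" for u v
    using f_int[of "-v" "-u"] Henstock_Kurzweil_Integration.integrable_reflect_real[of f "-u" "-v"] by simp
  \<comment> \<open>The end points are discarded so that both one-sided difference quotients at
    \<open>t\<close> can be taken inside \<open>{a..b}\<close>.\<close>
  from AE_lebesgue_reflect[OF right_lebesgue_point_AE[OF this]] right_lebesgue_point_AE[OF f_int]
    AE_lebesgue_neq[of a] AE_lebesgue_neq[of b]
  show ?thesis
  proof eventually_elim
    case (elim t)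
    show ?case
    proof
      assume "t \<in> {a..b}"
      with elim(3,4) have t: "a < t" "t < b"
        by auto
      have incr: "integral {a..v} \<phi> - integral {a..u} \<phi> = integral {u..v} f" if "a \<le> u" "u \<le> v" "v \<le> b" for u v
      proof -
        have "integral {a..u} \<phi> + integral {u..v} \<phi> = integral {a..v} \<phi>"
          using that by (intro Henstock_Kurzweil_Integration.integral_combine integrable_subinterval_real[OF \<phi>]) auto
        moreover have "integral {u..v} \<phi> = integral {u..v} f"
          using that by (intro integral_cong) (auto simp: f_def)
        ultimately show ?thesis
          by simp
      qed
      show "((\<lambda>t. integral {a..t} \<phi>) has_real_derivative \<phi> t) (at t)"
        unfolding has_field_derivative_iff
      proof (rule LIM_I)
        fix e :: real assume "e > 0"
        obtain d1 where d1: "d1 > 0" "\<And>h. 0 < h \<Longrightarrow> h < d1 \<Longrightarrow> \<bar>integral {- t..- t + h} (\<lambda>x. f (- x)) / h - f t\<bar> < e"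
          using elim(1) \<open>e > 0\<close> by (metis minus_minus)
        obtain d2 where d2: "d2 > 0" "\<And>h. 0 < h \<Longrightarrow> h < d2 \<Longrightarrow> \<bar>integral {t..t + h} f / h - f t\<bar> < e"
          using elim(2) \<open>e > 0\<close> by metis
        have "f t = \<phi> t"
          using t by (simp add: f_def)
        show "\<exists>s>0. \<forall>y. y \<noteq> t \<and> norm (y - t) < s \<longrightarrow>
            norm ((integral {a..y} \<phi> - integral {a..t} \<phi>) / (y - t) - \<phi> t) < e"
        proof (intro exI[of _ "min (min d1 d2) (min (t - a) (b - t))"] conjI allI impI; (elim conjE)?)
          fix y assume y: "y \<noteq> t" "norm (y - t) < min (min d1 d2) (min (t - a) (b - t))"
          show "norm ((integral {a..y} \<phi> - integral {a..t} \<phi>) / (y - t) - \<phi> t) < e"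
          proof (cases "t < y")
            case True
            then show ?thesis
              using incr[of t y] d2(2)[of "y - t"] y t \<open>f t = \<phi> t\<close> by simp
          next
            case False
            then have "y < t"
              using y(1) by simp
            have "integral {- t..- t + (t - y)} (\<lambda>x. f (- x)) = integral {y..t} f"
              using Henstock_Kurzweil_Integration.integral_reflect_real[of t y f] by simp
            also have "\<dots> = integral {a..t} \<phi> - integral {a..y} \<phi>"
              using incr[of y t] y t \<open>y < t\<close> by simp
            finally have "integral {- t..- t + (t - y)} (\<lambda>x. f (- x)) / (t - y)
                = (integral {a..y} \<phi> - integral {a..t} \<phi>) / (y - t)"
              by (metis minus_diff_eq minus_divide_divide)
            then show ?thesis
              using d1(2)[of "t - y"] y \<open>y < t\<close> \<open>f t = \<phi> t\<close> by simp
          qed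
        qed (use d1 d2 t in auto)
      qed
    qed
  qed
qed

subsection \<open>The space $W^{1,1}$ and its dual\<close>

text \<open>Any almost everywhere derivative may stand in for \<open>deriv f\<close>: the two agree
  off a null set, and integrability survives such a change.\<close>

lemma sobolev_W11I:
  assumes f: "abs_continuous_on {a..b} f"
    and deriv: "AE t in lebesgue. t \<in> {a..b} \<longrightarrow> (f has_real_derivative f' t) (at t)"
    and f': "f' absolutely_integrable_on {a..b}"
  shows "f \<in> sobolev_W11 {a..b}"
proof -
  have "AE t in lebesgue. t \<in> {a..b} \<longrightarrow> f differentiable (at t)"
    using deriv by eventually_elim (auto simp: real_differentiable_def)
  moreover have "deriv f absolutely_integrable_on {a..b}"
  proof (rule absolutely_integrable_spike[OF f'])
    show "negligible {t. \<not> (t \<in> {a..b} \<longrightarrow> (f has_real_derivative f' t) (at t))}"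
      using deriv by (simp only: AE_lebesgue_negligible)
  qed (auto intro: DERIV_imp_deriv)
  ultimately show ?thesis
    using f by (simp add: sobolev_W11_def)
qed

lemma sobolev_W11D:
  assumes "f \<in> sobolev_W11 I"
  shows "abs_continuous_on I f"
    and "AE t in lebesgue. t \<in> I \<longrightarrow> (f has_real_derivative deriv f t) (at t)"
    and "deriv f absolutely_integrable_on I"
  using assms by (auto simp: sobolev_W11_def DERIV_deriv_iff_real_differentiable)

lemma AE_interior_Icc: "AE t in lebesgue. t \<in> {a..b} \<longrightarrow> t \<in> {a<..<b}" for a b :: real
  using AE_lebesgue_neq[of a] AE_lebesgue_neq[of b] by eventually_elim auto

text \<open>A two-sided derivative depends on a neighbourhood of the point, and at an interior point
  this can be chosen where \<open>f\<close> and \<open>g\<close> agree. The end points left out form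
  a null set.\<close>

lemma has_real_derivative_cong_Ioo:
  assumes "(f has_real_derivative D) (at t)" "t \<in> {a<..<b}" "\<And>t. t \<in> {a..b} \<Longrightarrow> f t = g t"
  shows "(g has_real_derivative D) (at t)"
  using assms has_field_derivative_transform_within_open[of f D t "{a<..<b}" g] by auto

text \<open>This is for the Green's integral and \<open>green_per T m t (-T)\<close>, whose closed
  forms are available only for \<open>t\<close> in the interval.\<close>

lemma sobolev_W11_cong:
  assumes f: "f \<in> sobolev_W11 {a..b}" and eq: "\<And>t. t \<in> {a..b} \<Longrightarrow> f t = g t"
  shows "g \<in> sobolev_W11 {a..b}"
proof (rule sobolev_W11I)
  show "abs_continuous_on {a..b} g"
    using abs_continuous_on_cong[OF sobolev_W11D(1)[OF f] eq] .
  show "AE t in lebesgue. t \<in> {a..b} \<longrightarrow> (g has_real_derivative deriv f t) (at t)"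
    using sobolev_W11D(2)[OF f] AE_interior_Icc[of a b]
    by eventually_elim (auto intro: has_real_derivative_cong_Ioo[OF _ _ eq])
qed (rule sobolev_W11D(3)[OF f])

lemma sobolev_W11_add:
  assumes f: "f \<in> sobolev_W11 {a..b}" and g: "g \<in> sobolev_W11 {a..b}"
  shows "(\<lambda>t. f t + g t) \<in> sobolev_W11 {a..b}"
proof (rule sobolev_W11I)
  show "AE t in lebesgue. t \<in> {a..b} \<longrightarrow> ((\<lambda>t. f t + g t) has_real_derivative deriv f t + deriv g t) (at t)"
    using sobolev_W11D(2)[OF f] sobolev_W11D(2)[OF g] by eventually_elim (auto intro: DERIV_add)
qed (use sobolev_W11D[OF f] sobolev_W11D[OF g] in \<open>auto intro: abs_continuous_on_add\<close>)

lemma absolutely_integrable_continuous_mult: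
  fixes f g :: "real \<Rightarrow> real"
  assumes "continuous_on {a..b} f" "g absolutely_integrable_on {a..b}"
  shows "(\<lambda>t. f t * g t) absolutely_integrable_on {a..b}"
  using assms
  by (intro absolutely_integrable_bounded_measurable_product_real continuous_imp_measurable_on_sets_lebesgue
      compact_imp_bounded compact_continuous_image) auto

lemma sobolev_W11_mult:
  assumes f: "f \<in> sobolev_W11 {a..b}" and g: "g \<in> sobolev_W11 {a..b}"
  shows "(\<lambda>t. f t * g t) \<in> sobolev_W11 {a..b}"
proof (rule sobolev_W11I)
  show "AE t in lebesgue. t \<in> {a..b} \<longrightarrow>
      ((\<lambda>t. f t * g t) has_real_derivative f t * deriv g t + g t * deriv f t) (at t)"
    using sobolev_W11D(2)[OF f] sobolev_W11D(2)[OF g]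
    by eventually_elim (auto intro!: derivative_eq_intros)
  show "(\<lambda>t. f t * deriv g t + g t * deriv f t) absolutely_integrable_on {a..b}"
    using sobolev_W11D(1,3)[OF f] sobolev_W11D(1,3)[OF g]
    by (intro set_integral_add(1) absolutely_integrable_continuous_mult abs_continuous_on_imp_continuous_on)
qed (use sobolev_W11D(1)[OF f] sobolev_W11D(1)[OF g] in \<open>auto intro: abs_continuous_on_mult\<close>)

lemma sobolev_W11_reflect:
  assumes f: "f \<in> sobolev_W11 {-T..T}"
  shows "(\<lambda>t. f (- t)) \<in> sobolev_W11 {-T..T}"
proof (rule sobolev_W11I)
  show "AE t in lebesgue. t \<in> {-T..T} \<longrightarrow> ((\<lambda>t. f (- t)) has_real_derivative - deriv f (- t)) (at t)"
    using AE_lebesgue_reflect[OF sobolev_W11D(2)[OF f]]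
    by eventually_elim (auto intro!: derivative_eq_intros simp: DERIV_mirror)
  have "(\<lambda>t. deriv f (- t)) absolutely_integrable_on {-T..T}"
    using sobolev_W11D(3)[OF f] absolutely_integrable_reflect_real[of T "-T" "deriv f"] by simp
  then show "(\<lambda>t. - deriv f (- t)) absolutely_integrable_on {-T..T}"
    unfolding set_integrable_def by (metis (no_types, lifting) ext scaleR_minus_right integrable_minus)
qed (intro abs_continuous_on_reflect sobolev_W11D(1)[OF f])

lemma sobolev_W11_integral:
  fixes \<phi> :: "real \<Rightarrow> real"
  assumes "\<phi> absolutely_integrable_on {a..b}"
  shows "(\<lambda>t. integral {a..t} \<phi>) \<in> sobolev_W11 {a..b}"
  using integral_has_real_derivative_AE[OF set_lebesgue_integral_eq_integral(1)[OF assms]]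
  by (rule sobolev_W11I[OF abs_continuous_on_integral[OF assms] _ assms])

text \<open>By the fundamental theorem of calculus the increments of \<open>f\<close> are those of
  the primitive of \<open>f'\<close>, whose absolute continuity is known.\<close>

lemma sobolev_W11_C1:
  assumes f: "\<And>t. (f has_real_derivative f' t) (at t)" and cont: "continuous_on {a..b} f'"
  shows "f \<in> sobolev_W11 {a..b}"
proof (rule sobolev_W11I)
  have f': "f' absolutely_integrable_on {a..b}"
    using cont by (rule absolutely_integrable_continuous_real)
  then show "f' absolutely_integrable_on {a..b}" .
  show "AE t in lebesgue. t \<in> {a..b} \<longrightarrow> (f has_real_derivative f' t) (at t)"
    using f by simp
  let ?I = "\<lambda>t. integral {a..t} f'"
  have I: "?I t = f t - f a" if "a \<le> t" for t
    using that f
    by (intro integral_unique fundamental_theorem_of_calculus)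
      (auto simp: has_real_derivative_iff_has_vector_derivative intro: has_vector_derivative_at_within)
  show "abs_continuous_on {a..b} f"
  proof (rule abs_continuous_on_dominated[of _ ?I ?I 1])
    fix u v assume "u \<le> v" "{u..v} \<subseteq> {a..b}"
    then have "?I u = f u - f a" "?I v = f v - f a"
      using I by auto
    then show "\<bar>f v - f u\<bar> \<le> 1 * (\<bar>?I v - ?I u\<bar> + \<bar>?I v - ?I u\<bar>)"
      by simp
  qed (use abs_continuous_on_integral[OF f'] in auto)
qed

text \<open>The difference \<open>g - f\<close> has norm 0, so \<open>g\<close> lies within every
  \<open>\<delta>\<close> of \<open>f\<close>, and continuity of \<open>F\<close> at
  \<open>f\<close> applies with every \<open>\<epsilon>\<close>.\<close>

lemma dual_W11_cong:
  assumes F: "F \<in> dual_W11 {a..b}"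
    and f: "f \<in> sobolev_W11 {a..b}" and eq: "\<And>t. t \<in> {a..b} \<Longrightarrow> f t = g t"
  shows "F f = F g"
proof -
  have g: "g \<in> sobolev_W11 {a..b}"
    using sobolev_W11_cong[OF f eq] .
  have "AE t in lebesgue. t \<in> {a..b} \<longrightarrow> deriv (\<lambda>t. g t - f t) t = 0"
    using AE_interior_Icc[of a b]
  proof eventually_elim
    case (elim t)
    show ?case
    proof
      assume "t \<in> {a..b}"
      with elim have "t \<in> {a<..<b}"
        by blast
      have "((\<lambda>t. g t - f t) has_real_derivative 0) (at t)"
        by (rule has_real_derivative_cong_Ioo[OF DERIV_const[of 0] \<open>t \<in> {a<..<b}\<close>]) (use eq in auto)
      then show "deriv (\<lambda>t. g t - f t) t = 0"
        by (rule DERIV_imp_deriv)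
    qed
  qed
  then have "(LINT t:{a..b}|lebesgue. \<bar>deriv (\<lambda>t. g t - f t) t\<bar>) = 0"
    unfolding set_lebesgue_integral_def
    by (intro integral_eq_zero_AE) (auto elim!: eventually_mono simp: indicator_def)
  moreover have "(LINT t:{a..b}|lebesgue. \<bar>g t - f t\<bar>) = 0"
    unfolding set_lebesgue_integral_def
    by (intro integral_eq_zero_AE) (auto simp: indicator_def eq)
  ultimately have norm: "norm_W11 {a..b} (\<lambda>t. g t - f t) = 0"
    by (simp add: norm_W11_def)
  have "\<bar>F g - F f\<bar> < \<epsilon>" if "\<epsilon> > 0" for \<epsilon>
  proof -
    obtain \<delta> where "\<delta> > 0"
      "\<And>g. g \<in> sobolev_W11 {a..b} \<Longrightarrow> norm_W11 {a..b} (\<lambda>t. g t - f t) < \<delta> \<Longrightarrow> \<bar>F g - F f\<bar> < \<epsilon>"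
      using F f \<open>\<epsilon> > 0\<close> unfolding dual_W11_def by blast
    then show ?thesis
      using g norm by simp
  qed
  then have "\<not> \<bar>F g - F f\<bar> > 0"
    by blast
  then show ?thesis
    by simp
qed

subsection \<open>The equation with reflection\<close>

text \<open>
  Apart from the tests \<open>s \<le> t\<close> and \<open>s \<le> - t\<close> the variables are separated, so that integration against \<open>h\<close> gives
  primitives of \<open>cos (m * s) * h s\<close> and \<open>sin (m * s) * h s\<close> evaluated at \<open>t\<close> and \<open>- t\<close>.
\<close>

lemma green_per_kernel:
  fixes T m t s :: real
  assumes "T > 0" "sin (m * T) \<noteq> 0" "t \<in> {-T..T}" "s \<in> {-T..T}" "s \<noteq> t"
  shows "green_per T m t s =
    (if s \<le> t then cos (m * t) * cos (m * s) + sin (m * t) * sin (m * s) else 0)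
    - (if s \<le> - t then cos (m * t) * sin (m * s) + sin (m * t) * cos (m * s) else 0)
    + ((cos (m * T) - sin (m * T)) / (2 * sin (m * T)) * cos (m * s)
       + (cos (m * T) + sin (m * T)) / (2 * sin (m * T)) * sin (m * s)) * (cos (m * t) - sin (m * t))"
proof -
  have shift: "cos (x - pi / 4) = sqrt 2 / 2 * (cos x + sin x)"
    "cos (x + pi / 4) = sqrt 2 / 2 * (cos x - sin x)" for x
    by (simp_all add: cos_add cos_diff cos_45 sin_45 algebra_simps)
  have half: "sqrt 2 / 2 * A * (sqrt 2 / 2 * B) = A * B / 2" for A B :: real
    by simp
  have args: "m * T * (1 - t / T) = m * T - m * t" "m * T * (s / T) = m * s"
    "m * T * (t / T + 1) = m * t + m * T" "m * T * (t / T) = m * t"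
    "m * T * (s / T - 1) = m * s - m * T" "m * T * (1 + s / T) = m * T + m * s"
    using \<open>T > 0\<close> by (simp_all add: field_simps)
  have abs_divide_pos: "\<bar>x / T\<bar> = \<bar>x\<bar> / T" for x
    using \<open>T > 0\<close> by simp
  have regions: "t / T > \<bar>s / T\<bar> \<longleftrightarrow> t > \<bar>s\<bar>" "t / T < - \<bar>s / T\<bar> \<longleftrightarrow> t < - \<bar>s\<bar>" "\<bar>t / T\<bar> \<le> s / T \<longleftrightarrow> \<bar>t\<bar> \<le> s"
    using \<open>T > 0\<close> by (simp_all add: abs_divide_pos field_simps)
  have green: "green_per T m t s =
    (if t > \<bar>s\<bar> then (cos (m * T - m * t) + sin (m * T - m * t)) * (cos (m * s) + sin (m * s)) / 2
     else if t < - \<bar>s\<bar> then (cos (m * t + m * T) - sin (m * t + m * T)) * (cos (m * s) + sin (m * s)) / 2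
     else if \<bar>t\<bar> \<le> s then (cos (m * t) - sin (m * t)) * (cos (m * s - m * T) + sin (m * s - m * T)) / 2
     else (cos (m * t) - sin (m * t)) * (cos (m * T + m * s) + sin (m * T + m * s)) / 2) / sin (m * T)"
    unfolding green_per_def Let_def args regions shift half by (rule refl)
  note expand = cos_add cos_diff sin_add sin_diff add_divide_distrib diff_divide_distrib
    distrib_left distrib_right left_diff_distrib right_diff_distrib mult_ac
  consider (1) "t > \<bar>s\<bar>" | (2) "t < - \<bar>s\<bar>" | (3) "\<bar>t\<bar> \<le> s" "\<not> t > \<bar>s\<bar>" "\<not> t < - \<bar>s\<bar>"
    | (4) "\<not> t > \<bar>s\<bar>" "\<not> t < - \<bar>s\<bar>" "\<not> \<bar>t\<bar> \<le> s"
    by blast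
  then show ?thesis
  proof cases
    case 1
    then have "s \<le> t" "\<not> s \<le> - t"
      by auto
    with 1 show ?thesis
      using assms(2) unfolding green by (simp add: expand)
  next
    case 2
    then have "\<not> s \<le> t" "s \<le> - t" "\<not> t > \<bar>s\<bar>"
      by auto
    with 2 show ?thesis
      using assms(2) unfolding green by (simp add: expand)
  next
    case 3
    \<comment> \<open>On the antidiagonal the test \<open>s \<le> - t\<close> succeeds, but its
      summand is the expansion of \<open>sin (m * (s + t))\<close> and vanishes there.\<close>
    then have "\<not> s \<le> t" "s \<le> - t \<longleftrightarrow> s = - t"
      using \<open>s \<noteq> t\<close> by auto
    with 3 show ?thesis
      using assms(2) unfolding green by (cases "s = - t") (simp_all add: expand)
  next
    case 4
    then have "s \<le> t" "s \<le> - t"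
      by auto
    with 4 show ?thesis
      using assms(2) unfolding green by (simp add: expand)
  qed
qed

lemma sobolev_W11_const: "(\<lambda>t. c) \<in> sobolev_W11 {a..b}"
  by (rule sobolev_W11_C1[of _ "\<lambda>_. 0"]) auto

lemma sobolev_W11_diff:
  assumes "f \<in> sobolev_W11 {a..b}" "g \<in> sobolev_W11 {a..b}"
  shows "(\<lambda>t. f t - g t) \<in> sobolev_W11 {a..b}"
  using sobolev_W11_add[OF assms(1) sobolev_W11_mult[OF sobolev_W11_const assms(2), of "-1"]] by simp

lemma sobolev_W11_cos: "(\<lambda>t. cos (m * t)) \<in> sobolev_W11 {a..b}"
  by (rule sobolev_W11_C1[of _ "\<lambda>t. - (m * sin (m * t))"])
    (auto intro!: derivative_eq_intros continuous_intros)

lemma sobolev_W11_sin: "(\<lambda>t. sin (m * t)) \<in> sobolev_W11 {a..b}"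
  by (rule sobolev_W11_C1[of _ "\<lambda>t. m * cos (m * t)"])
    (auto intro!: derivative_eq_intros continuous_intros)

lemmas sobolev_W11_intros = sobolev_W11_add sobolev_W11_diff sobolev_W11_mult
  sobolev_W11_const sobolev_W11_cos sobolev_W11_sin

section \<open>Variation of constants\<close>

text \<open>The terms with \<open>C\<close> and \<open>S\<close> form a particular solution of the
  equation; \<open>r\<close> parametrises the homogeneous solutions.\<close>

definition reflection_solution :: "real \<Rightarrow> real \<Rightarrow> (real \<Rightarrow> real) \<Rightarrow> real \<Rightarrow> real \<Rightarrow> real" where
  "reflection_solution T m h r t =
     (let C = (\<lambda>t. integral {-T..t} (\<lambda>s. cos (m * s) * h s));
          S = (\<lambda>t. integral {-T..t} (\<lambda>s. sin (m * s) * h s))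
      in cos (m * t) * (C t - S (- t)) + sin (m * t) * (S t - C (- t)) + r * (cos (m * t) - sin (m * t)))"

lemma cos_sin_mult_absolutely_integrable:
  fixes h :: "real \<Rightarrow> real"
  assumes "h absolutely_integrable_on {a..b}"
  shows "(\<lambda>s. cos (m * s) * h s) absolutely_integrable_on {a..b}"
    and "(\<lambda>s. sin (m * s) * h s) absolutely_integrable_on {a..b}"
  by (intro absolutely_integrable_continuous_mult assms continuous_intros)+

lemma reflection_solution_sobolev_W11:
  assumes "h absolutely_integrable_on {-T..T}"
  shows "reflection_solution T m h r \<in> sobolev_W11 {-T..T}"
proof -
  note int = cos_sin_mult_absolutely_integrable[OF assms, of m, THEN sobolev_W11_integral]
  show ?thesis
    unfolding reflection_solution_def[abs_def] Let_def
    by (intro sobolev_W11_intros int int[THEN sobolev_W11_reflect])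
qed

text \<open>For almost every \<open>t\<close> both primitives are differentiable at \<open>t\<close>
  and at \<open>- t\<close>. In the product rule the terms with \<open>h (- t)\<close> cancel, those
  with \<open>h t\<close> add up to \<open>h t\<close>, and the rest is \<open>- m\<close> times the
  reflected value.\<close>

lemma reflection_solution_deriv:
  assumes h: "h absolutely_integrable_on {-T..T}"
  shows "AE t in lebesgue. t \<in> {-T..T} \<longrightarrow>
    (reflection_solution T m h r has_real_derivative h t - m * reflection_solution T m h r (- t)) (at t)"
proof -
  define C where "C = (\<lambda>t. integral {-T..t} (\<lambda>s. cos (m * s) * h s))"
  define S where "S = (\<lambda>t. integral {-T..t} (\<lambda>s. sin (m * s) * h s))"
  have u: "reflection_solution T m h r = (\<lambda>t. cos (m * t) * (C t - S (- t)) + sin (m * t) * (S t - C (- t))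
      + r * (cos (m * t) - sin (m * t)))"
    by (simp add: fun_eq_iff reflection_solution_def C_def S_def)
  have "AE t in lebesgue. t \<in> {-T..T} \<longrightarrow> (C has_real_derivative cos (m * t) * h t) (at t)"
    "AE t in lebesgue. t \<in> {-T..T} \<longrightarrow> (S has_real_derivative sin (m * t) * h t) (at t)"
    unfolding C_def S_def
    by (intro integral_has_real_derivative_AE set_lebesgue_integral_eq_integral(1)
        cos_sin_mult_absolutely_integrable h)+
  from this this[THEN AE_lebesgue_reflect] show ?thesis
  proof eventually_elim
    case (elim t)
    show ?case
    proof
      assume "t \<in> {-T..T}"
      with elim have d: "(C has_real_derivative cos (m * t) * h t) (at t)"
          "(S has_real_derivative sin (m * t) * h t) (at t)"
        and "(C has_real_derivative cos (m * t) * h (- t)) (at (- t))"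
          "(S has_real_derivative - (sin (m * t) * h (- t))) (at (- t))"
        by auto
      from this(3,4) have d': "((\<lambda>t. C (- t)) has_real_derivative - (cos (m * t) * h (- t))) (at t)"
          "((\<lambda>t. S (- t)) has_real_derivative sin (m * t) * h (- t)) (at t)"
        by (simp_all add: DERIV_mirror)
      \<comment> \<open>The isolated \<open>h t\<close> of the target is expanded to meet the
        squares produced by the product rule.\<close>
      have sq: "h t = cos (m * t) * (cos (m * t) * h t) + sin (m * t) * (sin (m * t) * h t)"
        using sin_cos_squared_add3[of "m * t"] by (simp flip: mult.assoc distrib_right)
      show "(reflection_solution T m h r has_real_derivative h t - m * reflection_solution T m h r (- t)) (at t)"
        unfolding u
        by (rule derivative_eq_intros d d' refl)+ (subst (3) sq, simp add: algebra_simps)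
    qed
  qed
qed

section \<open>Integration against the Green's function\<close>

text \<open>This turns the tests \<open>s \<le> t\<close> and \<open>s \<le> - t\<close> of the
  kernel into primitives evaluated at \<open>t\<close> and \<open>- t\<close>.\<close>

lemma truncated_integral:
  fixes f :: "real \<Rightarrow> real"
  assumes f: "f absolutely_integrable_on {a..b}" and "t \<le> b"
  shows "(\<lambda>s. if s \<le> t then f s else 0) absolutely_integrable_on {a..b}"
    and "((\<lambda>s. if s \<le> t then f s else 0) has_integral integral {a..t} f) {a..b}"
proof -
  have sub: "f absolutely_integrable_on {a..t}"
    using \<open>t \<le> b\<close> by (intro absolutely_integrable_on_subinterval[OF f]) auto
  then show "(\<lambda>s. if s \<le> t then f s else 0) absolutely_integrable_on {a..b}"
    unfolding set_integrable_def
    by (rule back_subst[of "integrable lebesgue"]) (use \<open>t \<le> b\<close> in \<open>auto simp: fun_eq_iff indicator_def\<close>)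
  have "((\<lambda>s. if s \<in> {a..t} then f s else 0) has_integral integral {a..t} f) {a..b}"
    using \<open>t \<le> b\<close> set_lebesgue_integral_eq_integral(1)[OF sub]
    by (subst has_integral_restrict) (auto intro: integrable_integral)
  then show "((\<lambda>s. if s \<le> t then f s else 0) has_integral integral {a..t} f) {a..b}"
    by (rule has_integral_eq[rotated]) auto
qed

text \<open>The summand of the kernel without tests integrates to a multiple of
  \<open>cos (m * t) - sin (m * t)\<close> with a coefficient free of \<open>t\<close>, so one
  \<open>r\<close> serves for all \<open>t\<close>.\<close>

lemma green_per_integral:
  fixes h :: "real \<Rightarrow> real"
  assumes "T > 0" "sin (m * T) \<noteq> 0" and h: "h absolutely_integrable_on {-T..T}"
  obtains r where "\<And>t. t \<in> {-T..T} \<Longrightarrow> (\<lambda>s. green_per T m t s * h s) absolutely_integrable_on {-T..T}"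
    "\<And>t. t \<in> {-T..T} \<Longrightarrow> (LINT s:{-T..T}|lebesgue. green_per T m t s * h s) = reflection_solution T m h r t"
proof -
  define hc where "hc = (\<lambda>s. cos (m * s) * h s)"
  define hs where "hs = (\<lambda>s. sin (m * s) * h s)"
  define p where "p = (cos (m * T) - sin (m * T)) / (2 * sin (m * T))"
  define q where "q = (cos (m * T) + sin (m * T)) / (2 * sin (m * T))"
  have hc: "hc absolutely_integrable_on {-T..T}" and hs: "hs absolutely_integrable_on {-T..T}"
    unfolding hc_def hs_def by (rule cos_sin_mult_absolutely_integrable[OF h])+
  have hI: "(hc has_integral integral {-T..T} hc) {-T..T}" "(hs has_integral integral {-T..T} hs) {-T..T}"
    using hc hs by (auto intro!: integrable_integral set_lebesgue_integral_eq_integral(1))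
  define r where "r = p * integral {-T..T} hc + q * integral {-T..T} hs"
  have "(\<lambda>s. green_per T m t s * h s) absolutely_integrable_on {-T..T} \<and>
      ((\<lambda>s. green_per T m t s * h s) has_integral reflection_solution T m h r t) {-T..T}"
    if t: "t \<in> {-T..T}" for t
  proof -
    define cut :: "(real \<Rightarrow> real) \<Rightarrow> real \<Rightarrow> real \<Rightarrow> real"
      where "cut = (\<lambda>f u s. if s \<le> u then f s else 0)"
    define k where "k = (\<lambda>s. cos (m * t) * (cut hc t s - cut hs (- t) s) + sin (m * t) * (cut hs t s - cut hc (- t) s)
        + (p * hc s + q * hs s) * (cos (m * t) - sin (m * t)))"
    have le: "t \<le> T" "- t \<le> T"
      using t by auto
    note tr = truncated_integral[OF hc le(1)] truncated_integral[OF hc le(2)]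
      truncated_integral[OF hs le(1)] truncated_integral[OF hs le(2)]
    have k_abs: "k absolutely_integrable_on {-T..T}"
      unfolding k_def cut_def
      by (intro set_integral_add(1) set_integral_diff(1) set_integrable_mult_right set_integrable_mult_left tr hc hs)
    have k_int: "(k has_integral reflection_solution T m h r t) {-T..T}"
      unfolding k_def cut_def reflection_solution_def Let_def r_def hc_def[symmetric] hs_def[symmetric] mult.commute[of r]
      by (intro has_integral_add has_integral_diff has_integral_mult_right has_integral_mult_left tr hI)
    \<comment> \<open>The kernel formula is available off the diagonal; the omitted point
      \<open>s = t\<close> is null.\<close>
    have eq: "green_per T m t s * h s = k s" if "s \<in> {-T..T} - {t}" for s
    proof -
      have "green_per T m t s = (if s \<le> t then cos (m * t) * cos (m * s) + sin (m * t) * sin (m * s) else 0)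
          - (if s \<le> - t then cos (m * t) * sin (m * s) + sin (m * t) * cos (m * s) else 0)
          + (p * cos (m * s) + q * sin (m * s)) * (cos (m * t) - sin (m * t))"
        using green_per_kernel[OF assms(1,2) t, of s] that by (simp only: p_def q_def) blast
      then show ?thesis
        unfolding k_def cut_def hc_def hs_def by (simp only:) (simp add: algebra_simps)
    qed
    show ?thesis
      using absolutely_integrable_spike[OF k_abs negligible_sing[of t] eq]
        has_integral_spike[OF negligible_sing[of t] eq k_int]
      by simp
  qed
  then show thesis
    by (intro that[of r]) (auto simp: set_lebesgue_integral_eq_integral(2) integral_unique)
qed

section \<open>The homogeneous equation\<close>

text \<open>With y(t) = d(-t) the equation at \<open>t\<close> and at \<open>- t\<close> reads d' =
  - m y, y' = m d, so the pair (d, y) rotates by the angle \<open>m * t\<close>. \<open>P\<close>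
  and \<open>Q\<close> are its coordinates after undoing the rotation, and both equal
  \<open>d 0\<close> at 0.\<close>

lemma homogeneous_reflection_solution:
  assumes d: "d \<in> sobolev_W11 {-T..T}" and "T > 0"
    and ode: "AE t in lebesgue. t \<in> {-T..T} \<longrightarrow> deriv d t + m * d (- t) = 0"
    and t: "t \<in> {-T..T}"
  shows "d t = d 0 * (cos (m * t) - sin (m * t))"
proof -
  define P where "P = (\<lambda>t. d t * cos (m * t) + d (- t) * sin (m * t))"
  define Q where "Q = (\<lambda>t. d (- t) * cos (m * t) - d t * sin (m * t))"
  have "P \<in> sobolev_W11 {-T..T}" "Q \<in> sobolev_W11 {-T..T}"
    unfolding P_def Q_def by (intro sobolev_W11_intros d sobolev_W11_reflect[OF d])+
  note AC = this[THEN sobolev_W11D(1)]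
  have "AE t in lebesgue. t \<in> {-T..T} \<longrightarrow> (d has_real_derivative - m * d (- t)) (at t)"
    using sobolev_W11D(2)[OF d] ode
    by eventually_elim (metis eq_neg_iff_add_eq_0 mult_minus_left)
  from this AE_lebesgue_reflect[OF this]
  have deriv: "AE t in lebesgue. t \<in> {-T..T} \<longrightarrow>
    (d has_real_derivative - m * d (- t)) (at t) \<and> ((\<lambda>t. d (- t)) has_real_derivative m * d t) (at t)"
    by eventually_elim (auto simp: DERIV_mirror)
  have const: "AE t in lebesgue. t \<in> {-T..T} \<longrightarrow> (P has_real_derivative 0) (at t)"
    "AE t in lebesgue. t \<in> {-T..T} \<longrightarrow> (Q has_real_derivative 0) (at t)"
    unfolding P_def Q_def using deriv
    by (eventually_elim, auto intro!: derivative_eq_intros simp: algebra_simps)+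
  have "P t = P 0" "Q t = Q 0"
    using abs_continuous_on_zero_deriv[OF AC(1) const(1) t, of 0]
      abs_continuous_on_zero_deriv[OF AC(2) const(2) t, of 0] \<open>T > 0\<close> by auto
  then have PQ: "P t = d 0" "Q t = d 0"
    by (simp_all add: P_def Q_def)
  have "P t * cos (m * t) - Q t * sin (m * t) = d t * (cos (m * t) * cos (m * t) + sin (m * t) * sin (m * t))"
    unfolding P_def Q_def by algebra
  then show ?thesis
    by (simp add: PQ algebra_simps)
qed

section \<open>Existence and uniqueness for the functional condition\<close>

text \<open>Integrability of the integrand and \<open>F g \<noteq> 0\<close> are asserted too, since
  otherwise the integral or the quotient could be a default value 0. Uniqueness concerns values on
  the interval, where total functions represent elements of the space.\<close>

theorem corollary1p4:
  fixes T m c :: real and h :: "real \<Rightarrow> real" and F :: "(real \<Rightarrow> real) \<Rightarrow> real"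
  assumes "T > 0"
    and "\<forall>k::int. m \<noteq> of_int k * pi / T"
    and "set_integrable lebesgue {-T..T} h"
    and "F \<in> dual_W11 {-T..T}"
    and "F (\<lambda>t. cos (m * t)) \<noteq> F (\<lambda>t. sin (m * t))"
  shows "let w = (\<lambda>t. LINT s:{-T..T}|lebesgue. green_per T m t s * h s);
             g = (\<lambda>t. green_per T m t (-T));
             u = (\<lambda>t. w t + (c - F w) / F g * g t)
         in (\<forall>t\<in>{-T..T}. set_integrable lebesgue {-T..T} (\<lambda>s. green_per T m t s * h s)) \<and>
            w \<in> sobolev_W11 {-T..T} \<and> g \<in> sobolev_W11 {-T..T} \<and> F g \<noteq> 0 \<and>
            is_solution T m h F c u \<and>
            (\<forall>x. is_solution T m h F c x \<longrightarrow> (\<forall>t\<in>{-T..T}. x t = u t))"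
proof -
  define w where "w = (\<lambda>t. LINT s:{-T..T}|lebesgue. green_per T m t s * h s)"
  define g where "g = (\<lambda>t. green_per T m t (-T))"
  define k where "k = (c - F w) / F g"
  define u where "u = (\<lambda>t. w t + k * g t)"
  let ?cs = "\<lambda>t. cos (m * t) - sin (m * t)"
  have sin: "sin (m * T) \<noteq> 0"
  proof
    assume "sin (m * T) = 0"
    then obtain i :: int where "m * T = of_int i * pi"
      using sin_zero_iff_int2 by blast
    then have "m = of_int i * pi / T"
      using \<open>T > 0\<close> by (simp add: field_simps)
    with assms(2) show False
      by blast
  qed
  have F_add: "F (\<lambda>t. f t + f' t) = F f + F f'" and F_scale: "F (\<lambda>t. a * f t) = a * F f"
    if "f \<in> sobolev_W11 {-T..T}" "f' \<in> sobolev_W11 {-T..T}" for f f' a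
    using assms(4) that by (auto simp: dual_W11_def)
  have F_diff: "F (\<lambda>t. f t - f' t) = F f - F f'"
    if "f \<in> sobolev_W11 {-T..T}" "f' \<in> sobolev_W11 {-T..T}" for f f'
    using F_add[OF that(1) sobolev_W11_mult[OF sobolev_W11_const that(2)], of "-1"] F_scale[OF that(2,2), of "-1"]
    by simp
  have cs: "?cs \<in> sobolev_W11 {-T..T}"
    by (intro sobolev_W11_intros)
  \<comment> \<open>This evaluates \<open>F\<close> on all homogeneous solutions; it gives
    \<open>F g \<noteq> 0\<close> and later forces \<open>d 0 = 0\<close>.\<close>
  have F_cs: "F (\<lambda>t. a * ?cs t) = a * (F (\<lambda>t. cos (m * t)) - F (\<lambda>t. sin (m * t)))" for a
    using F_scale[OF cs cs] F_diff[OF sobolev_W11_cos sobolev_W11_sin] by simp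

  obtain r where int: "\<And>t. t \<in> {-T..T} \<Longrightarrow> (\<lambda>s. green_per T m t s * h s) absolutely_integrable_on {-T..T}"
    and w_eq: "\<And>t. t \<in> {-T..T} \<Longrightarrow> w t = reflection_solution T m h r t"
    using green_per_integral[OF \<open>T > 0\<close> sin assms(3)] unfolding w_def by metis
  have g_eq: "g t = 1 / (2 * sin (m * T)) * ?cs t" if "t \<in> {-T..T}" for t
    using green_per_left_endpoint[OF \<open>T > 0\<close> that] by (simp add: g_def)
  have w: "w \<in> sobolev_W11 {-T..T}"
    by (rule sobolev_W11_cong[OF reflection_solution_sobolev_W11[OF assms(3)] w_eq[symmetric]])
  have g': "(\<lambda>t. 1 / (2 * sin (m * T)) * ?cs t) \<in> sobolev_W11 {-T..T}"
    by (intro sobolev_W11_intros)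
  have g: "g \<in> sobolev_W11 {-T..T}"
    by (rule sobolev_W11_cong[OF g' g_eq[symmetric]])
  have "F g = 1 / (2 * sin (m * T)) * (F (\<lambda>t. cos (m * t)) - F (\<lambda>t. sin (m * t)))"
    using dual_W11_cong[OF assms(4) g' g_eq[symmetric]] unfolding F_cs by simp
  then have "F g \<noteq> 0"
    using assms(5) sin by simp
  have u: "u \<in> sobolev_W11 {-T..T}"
    unfolding u_def by (intro sobolev_W11_intros w g)
  have "F u = F w + k * F g"
    unfolding u_def using F_add[OF w sobolev_W11_mult[OF sobolev_W11_const g]] F_scale[OF g g] by simp
  then have Fu: "F u = c"
    using \<open>F g \<noteq> 0\<close> by (simp add: k_def)
  \<comment> \<open>The shift of \<open>r\<close> comes from the factor
    \<open>1 / (2 * sin (m * T))\<close> in the closed form of \<open>g\<close>.\<close>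
  have u_eq: "u t = reflection_solution T m h (r + k / (2 * sin (m * T))) t" if "t \<in> {-T..T}" for t
    by (simp add: u_def w_eq[OF that] g_eq[OF that] reflection_solution_def Let_def algebra_simps)
  \<comment> \<open>The closed form of \<open>u\<close> holds on the interval only, so its
    derivative is transferred at interior points.\<close>
  have ode: "AE t in lebesgue. t \<in> {-T..T} \<longrightarrow> (u has_real_derivative h t - m * u (- t)) (at t)"
    using reflection_solution_deriv[OF assms(3), of m "r + k / (2 * sin (m * T))"] AE_interior_Icc[of "-T" T]
  proof eventually_elim
    case (elim t)
    show ?case
    proof
      assume t: "t \<in> {-T..T}"
      with elim have "t \<in> {-T<..<T}" and "(reflection_solution T m h (r + k / (2 * sin (m * T)))
          has_real_derivative h t - m * reflection_solution T m h (r + k / (2 * sin (m * T))) (- t)) (at t)"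
        by auto
      with u_eq[of "- t"] t show "(u has_real_derivative h t - m * u (- t)) (at t)"
        by (intro has_real_derivative_cong_Ioo[OF _ _ u_eq[symmetric]]) auto
    qed
  qed
  have "is_solution T m h F c u"
    unfolding is_solution_def using u Fu ode by (auto elim!: eventually_mono dest!: DERIV_imp_deriv)
  moreover have "x t = u t" if x: "is_solution T m h F c x" and t: "t \<in> {-T..T}" for x t
  proof -
    define d where "d = (\<lambda>t. x t - u t)"
    have xs: "x \<in> sobolev_W11 {-T..T}" and Fx: "F x = c"
      using x by (auto simp: is_solution_def)
    have d: "d \<in> sobolev_W11 {-T..T}"
      unfolding d_def by (intro sobolev_W11_diff xs u)
    have "AE t in lebesgue. t \<in> {-T..T} \<longrightarrow> deriv x t + m * x (- t) = h t"
      using x by (simp add: is_solution_def)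
    then have "AE t in lebesgue. t \<in> {-T..T} \<longrightarrow> deriv d t + m * d (- t) = 0"
      using ode sobolev_W11D(2)[OF xs]
    proof eventually_elim
      case (elim t)
      show ?case
      proof
        assume "t \<in> {-T..T}"
        with elim have "(d has_real_derivative deriv x t - (h t - m * u (- t))) (at t)"
          unfolding d_def by (intro DERIV_diff) auto
        with elim \<open>t \<in> {-T..T}\<close> show "deriv d t + m * d (- t) = 0"
          by (auto simp: d_def algebra_simps dest!: DERIV_imp_deriv)
      qed
    qed
    note d_eq = homogeneous_reflection_solution[OF d \<open>T > 0\<close> this]
    have "F d = 0"
      unfolding d_def using F_diff[OF xs u] Fx Fu by simp
    moreover have "F d = d 0 * (F (\<lambda>t. cos (m * t)) - F (\<lambda>t. sin (m * t)))"
      using dual_W11_cong[OF assms(4) d d_eq] F_cs by simp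
    ultimately have "d 0 = 0"
      using assms(5) by simp
    then show ?thesis
      using d_eq[OF t] by (simp add: d_def)
  qed
  ultimately show ?thesis
    using int w g \<open>F g \<noteq> 0\<close> unfolding Let_def u_def k_def w_def g_def by blast
qed

end
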